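(* Let $(T,d)$ be a metric space and $m$ a Borel probability measure on $T$ with $\operatorname{supp}(m)=T$. Let $a,b\ge0$, $\varphi\in\mathcal{G}_{a,b}$ and $R\ge 2$; put $A=\frac{R^3}{(R-1)(R-2)}$, $B=\frac{R^2}{R-1}$ and $K=(aA+bB)\,\mathcal{S}$. Let $\psi:\mathbb{R}_+\to\mathbb{R}$ be an increasing, continuous function with $\psi(0)=0$, and let $\alpha,\beta\ge0$ be such that $$\psi(x)\le\alpha+\beta\frac{\varphi(xy)}{\varphi(y)}\qquad\text{for all }x\ge0,\ y>0.$$ Then for each separable real-valued stochastic process $X(t)$, $t\in T$, which satisfies $$\sup_{s,t\in T}\mathbf{E}\,\varphi\left(\frac{|X(s)-X(t)|}{d(s,t)}\right)\le 1,$$ the following inequality holds: $$\mathbf{E}\sup_{s,t\in T}\psi\left(\frac{|X(s)-X(t)|}{2K}\right)\le\alpha+\beta.$$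
   Context: $B(x,\varepsilon)=\{y\in T:d(x,y)\le\varepsilon\}$ is the closed ball and $D(T)=\sup\{d(s,t):s,t\in T\}$ the diameter of $T$ (possibly $+\infty$). For $a,b\ge0$, $\mathcal{G}_{a,b}$ is the class of all functions $\varphi:\mathbb{R}_+\to\mathbb{R}$ that are (strictly) increasing and continuous, satisfy $\varphi(0)=0$, and satisfy $x\le a+b\frac{\varphi(xy)}{\varphi(y)}$ for all $x\ge 0$, $y\ge\varphi^{-1}(1)$; it is understood that the inverse $\varphi^{-1}$ is defined on $[0,\infty)$. Define $\mathcal{S}=\sup_{x\in T}\int_0^{D(T)}\varphi^{-1}\left(\frac{1}{m(B(x,\varepsilon))}\right)d\varepsilon\in[0,\infty]$. Conventions: $0/0=0$ (so the terms with $s=t$ contribute $0$); for $R=2$, $A=+\infty$; $0\cdot\infty=0$; and a finite number divided by $+\infty$ is $0$. For a separable process, expectations of suprema over $T$ are understood as suprema over finite subsets: $\mathbf{E}\sup_{s,t\in T}\psi(|X(s)-X(t)|/(2K)):=\sup_{F\subset T,\ F\text{ finite}}\mathbf{E}\sup_{s,t\in F}\psi(|X(s)-X(t)|/(2K))$. *)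

theory Defs
  imports "HOL-Probability.Probability"
begin

text \<open>
  The metric space \<open>T\<close> is the universe of a type of class \<^class>\<open>metric_space\<close>.
  Functions on the half-line \<open>[0, \<infinity>)\<close> are functions on \<^typ>\<open>real\<close> of which only the values
  on \<open>{0..}\<close> are ever used.
\<close>

definition msupport :: "'a::topological_space measure \<Rightarrow> 'a set" where
  "msupport m = {x. \<forall>U. open U \<and> x \<in> U \<longrightarrow> emeasure m U > 0}"

abbreviation phi_inv :: "(real \<Rightarrow> real) \<Rightarrow> real \<Rightarrow> real" where
  "phi_inv \<phi> \<equiv> inv_into {0..} \<phi>"

text \<open>The condition on the image says that the inverse is defined on all of \<open>[0, \<infinity>)\<close>.\<close>

definition class_G :: "real \<Rightarrow> real \<Rightarrow> (real \<Rightarrow> real) set" where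
  "class_G a b = {\<phi>. strict_mono_on {0..} \<phi> \<and> continuous_on {0..} \<phi> \<and> \<phi> 0 = 0 \<and>
     \<phi> ` {0..} = {0..} \<and>
     (\<forall>x\<ge>0. \<forall>y\<ge>phi_inv \<phi> 1. x \<le> a + b * (\<phi> (x * y) / \<phi> y))}"

text \<open>
  The diameter takes values in \<open>[0, \<infinity>]\<close>; the library's \<^const>\<open>diameter\<close> is real-valued and
  is \<open>0\<close> on unbounded sets.
\<close>

definition ediam :: "'a::metric_space itself \<Rightarrow> ennreal" where
  "ediam _ = (SUP s::'a. SUP t::'a. ennreal (dist s t))"

definition majorizing_S :: "'a::metric_space measure \<Rightarrow> (real \<Rightarrow> real) \<Rightarrow> ennreal" where
  "majorizing_S m \<phi> = (SUP x::'a.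
     \<integral>\<^sup>+\<epsilon>\<in>{\<epsilon>. 0 < \<epsilon> \<and> ennreal \<epsilon> < ediam TYPE('a)}.
       ennreal (phi_inv \<phi> (1 / measure m (cball x \<epsilon>))) \<partial>lborel)"

text \<open>
  Separability: outside a null set, each value \<open>X t\<close> is a limit of values along a sequence
  converging to \<open>t\<close> in a fixed countable set (which is then necessarily dense).
\<close>

definition separable_process :: "'w measure \<Rightarrow> ('a::metric_space \<Rightarrow> 'w \<Rightarrow> real) \<Rightarrow> bool" where
  "separable_process M X \<longleftrightarrow> (\<exists>C. countable C \<and>
     (AE \<omega> in M. \<forall>t. \<exists>s :: nat \<Rightarrow> 'a. (\<forall>n. s n \<in> C) \<and> s \<longlonglongrightarrow> t \<and>
        (\<lambda>n. X (s n) \<omega>) \<longlonglongrightarrow> X t \<omega>))"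

text \<open>
  Expectation of the supremum over \<open>s, t\<close> of a nonnegative family \<open>Z s t\<close>, understood as the
  supremum over finite index sets.
\<close>

definition expectation_sup :: "'w measure \<Rightarrow> ('a \<Rightarrow> 'a \<Rightarrow> 'w \<Rightarrow> real) \<Rightarrow> ennreal" where
  "expectation_sup M Z = (SUP F\<in>{F :: 'a set. finite F}.
     \<integral>\<^sup>+\<omega>. (SUP s\<in>F. SUP t\<in>F. ennreal (Z s t \<omega>)) \<partial>M)"

text \<open>
  The quotient of a nonnegative real by an extended constant, with \<open>0 / 0 = 0\<close> and
  \<open>u / \<infinity> = 0\<close>. The first comes from division on \<^typ>\<open>real\<close>; the second needs its own case,
  because \<^const>\<open>enn2real\<close> sends \<open>\<infinity>\<close> to \<open>0\<close>.
\<close>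

definition ext_div :: "real \<Rightarrow> ennreal \<Rightarrow> real" where
  "ext_div u k = (if k = \<infinity> then 0 else u / enn2real k)"

end

theory Submission
  imports Defs
begin

text \<open>
  Put \<open>y\<^sub>k = \<phi>\<^sup>-\<^sup>1(1) R\<^sup>k\<close> and let \<open>r\<^sub>k(x)\<close> be the least radius with \<open>m(B(x, r\<^sub>k(x))) \<ge> 1 / \<phi>(y\<^sub>k)\<close>. Then
  \<open>r\<^sub>k\<close> is 1-Lipschitz and \<open>\<Sum>\<^sub>k y\<^sub>k r\<^sub>k(x) \<le> R / (R - 1) S\<close>. Let \<open>P\<^sub>k\<close> be the averaging operator over the
  balls \<open>B(x, r\<^sub>k(x))\<close>. Walking from \<open>x\<close> by \<open>P\<^sub>n, P\<^bsub>n-1\<^esub>, \<dots>, P\<^sub>0\<close>, the last step lands on a point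
  distributed as \<open>m\<close>, and the defining inequality of \<open>\<G>\<^bsub>a,b\<^esub>\<close> splits the increment of a path \<open>f\<close>
  at each step into two parts. The \<open>a\<close>-part is a multiple of \<open>y\<^bsub>k+1\<^esub> r\<^sub>k\<close> at the current point, which
  the Lipschitz property transports back to \<open>x\<close> at the cost of the factor \<open>R / (R - 2)\<close>. In the
  \<open>b\<close>-part, the bound \<open>\<phi>(y\<^sub>k)\<close> on the density of \<open>P\<^sub>k\<close> removes the dependence on \<open>x\<close>. So
  \<open>\<bar>f s - f t\<bar> \<le> 2 (a A S + b \<integral> \<phi>(\<bar>f u - f v\<bar> / d(u, v)) d\<nu>)\<close> for a fixed measure \<open>\<nu>\<close> of mass at
  most \<open>B S\<close>. Applied to \<open>f / z\<close> with \<open>z = \<bar>f s - f t\<bar> / (2 K)\<close>, this forces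
  \<open>\<integral> \<phi>(\<bar>f u - f v\<bar> / (z d(u, v))) d\<nu> \<ge> B S\<close>, and the growth condition on \<open>\<psi>\<close> bounds \<open>\<psi>(z)\<close> by
  \<open>\<alpha> + \<beta> \<integral> \<phi>(\<bar>f u - f v\<bar> / d(u, v)) d\<nu> / (B S)\<close>, whose expectation is at most \<open>\<alpha> + \<beta>\<close>.
  The process is Lipschitz into \<open>L\<^sup>1\<close>, so it can be replaced by a jointly measurable modification
  whose averages over shrinking balls converge.
\<close>

section \<open>Dense sequences and measurability\<close>

lemma countable_dense_approximation:
  fixes C :: "'a::metric_space set"
  assumes "countable C" "closure C = UNIV"
  obtains c :: "nat \<Rightarrow> 'a" and q :: "nat \<Rightarrow> 'a \<Rightarrow> nat"
  where "\<And>n. q n \<in> borel \<rightarrow>\<^sub>M count_space UNIV" "\<And>n x. dist x (c (q n x)) < (1 / 2) ^ n"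
proof
  define c where "c = from_nat_into C"
  define q where "q n x = (LEAST i. dist x (c i) < (1 / 2) ^ n)" for n :: nat and x :: 'a
  show "q n \<in> borel \<rightarrow>\<^sub>M count_space UNIV" for n
  proof -
    have "(\<lambda>x::'a. dist x (c i) < (1 / 2) ^ n) \<in> borel \<rightarrow>\<^sub>M count_space UNIV" for i
    proof -
      have "{x::'a. dist x (c i) < (1 / 2) ^ n} = ball (c i) ((1 / 2) ^ n)"
        by (auto simp: dist_commute)
      then have "{x::'a. dist x (c i) < (1 / 2) ^ n} \<in> sets borel" by auto
      then show ?thesis by (simp add: pred_def)
    qed
    then show ?thesis unfolding q_def by (rule measurable_Least)
  qed
  show "dist x (c (q n x)) < (1 / 2) ^ n" for n x
  proof -
    have "x \<in> closure C" using assms(2) by simp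
    then obtain z where "z \<in> C" "dist z x < (1 / 2) ^ n"
      unfolding closure_approachable by (meson zero_less_power zero_less_divide_1_iff zero_less_numeral)
    moreover obtain i where "z = c i"
      using from_nat_into_surj[OF assms(1) \<open>z \<in> C\<close>] c_def by metis
    ultimately have "\<exists>i. dist x (c i) < (1 / 2) ^ n" by (auto simp: dist_commute)
    then show ?thesis unfolding q_def by (rule LeastI_ex)
  qed
qed

locale dense_metric =
  fixes c :: "nat \<Rightarrow> 'a::metric_space" and q :: "nat \<Rightarrow> 'a \<Rightarrow> nat"
  assumes measurable_q [measurable]: "\<And>n. q n \<in> borel \<rightarrow>\<^sub>M count_space UNIV"
    and dist_q: "\<And>n x. dist x (c (q n x)) < (1 / 2) ^ n"
begin

lemma c_q_tendsto: "(\<lambda>n. c (q n x)) \<longlonglongrightarrow> x"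
proof (rule metric_tendsto_imp_tendsto[where f = "\<lambda>n. (1 / 2 :: real) ^ n" and a = 0])
  show "(\<lambda>n. (1 / 2 :: real) ^ n) \<longlonglongrightarrow> 0" by (rule LIMSEQ_realpow_zero) auto
  show "\<forall>\<^sub>F n in sequentially. dist (c (q n x)) x \<le> dist ((1 / 2 :: real) ^ n) 0"
    using dist_q[of x] by (auto simp: dist_commute less_imp_le)
qed

lemma borel_measurable_dist_pair:
  "(\<lambda>z. dist (fst z) (snd z)) \<in> borel_measurable (borel \<Otimes>\<^sub>M (borel :: 'a measure))"
proof (rule borel_measurable_LIMSEQ_real)
  show "(\<lambda>n. dist (fst z) (c (q n (snd z)))) \<longlonglongrightarrow> dist (fst z) (snd z)" for z
    by (intro tendsto_intros c_q_tendsto)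
  fix n
  have [measurable]: "(\<lambda>x::'a. dist x (c i)) \<in> borel_measurable borel" for i
    by (intro borel_measurable_continuous_onI continuous_intros)
  show "(\<lambda>z. dist (fst z) (c (q n (snd z)))) \<in> borel_measurable (borel \<Otimes>\<^sub>M borel)"
    by (rule measurable_compose_countable[where f = "\<lambda>i z. dist (fst z) (c i)" and g = "\<lambda>z. q n (snd z)"])
      measurable
qed

end

section \<open>Radii of the chaining balls\<close>

lemma phi_inv_image:
  assumes "\<phi> \<in> class_G a b" "0 \<le> t"
  shows "\<phi> (phi_inv \<phi> t) = t" "0 \<le> phi_inv \<phi> t"
proof -
  have "t \<in> \<phi> ` {0..}" using assms unfolding class_G_def by auto
  then show "\<phi> (phi_inv \<phi> t) = t" by (rule f_inv_into_f)
  show "0 \<le> phi_inv \<phi> t" using inv_into_into[OF \<open>t \<in> \<phi> ` {0..}\<close>] by simp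
qed

lemma class_G_less:
  assumes "\<phi> \<in> class_G a b" "0 \<le> x" "x < y"
  shows "\<phi> x < \<phi> y"
  using assms unfolding class_G_def strict_mono_on_def by auto

lemma class_G_mono:
  assumes "\<phi> \<in> class_G a b" "0 \<le> x" "x \<le> y"
  shows "\<phi> x \<le> \<phi> y"
  using class_G_less[OF assms(1,2), of y] assms(3) by (cases "x = y") simp_all

lemma class_G_nonneg:
  assumes "\<phi> \<in> class_G a b" "0 \<le> x"
  shows "0 \<le> \<phi> x"
  using assms class_G_mono[of \<phi> a b 0 x] unfolding class_G_def by auto

lemma class_G_b_pos:
  assumes "\<phi> \<in> class_G a b" "0 \<le> a" "0 \<le> b"
  shows "0 < b"
proof (rule ccontr)
  assume "\<not> 0 < b"
  then have "b = 0" using assms by simp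
  have "\<forall>x\<ge>0. \<forall>y\<ge>phi_inv \<phi> 1. x \<le> a + b * (\<phi> (x * y) / \<phi> y)"
    using assms(1) unfolding class_G_def by simp
  then have "a + 1 \<le> a + b * (\<phi> ((a + 1) * phi_inv \<phi> 1) / \<phi> (phi_inv \<phi> 1))"
    using assms(2) by (meson add_nonneg_nonneg order_refl zero_le_one)
  then have "a + 1 \<le> a" by (simp add: \<open>b = 0\<close>)
  then show False by simp
qed

locale majorizing_chain = prob_space m + dense_metric c q
  for m :: "'a::metric_space measure" and c :: "nat \<Rightarrow> 'a" and q :: "nat \<Rightarrow> 'a \<Rightarrow> nat" +
  fixes \<phi> :: "real \<Rightarrow> real" and a b R :: real
  assumes sets_m [measurable_cong]: "sets m = sets borel"
    and support_m: "msupport m = UNIV"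
    and \<phi>: "\<phi> \<in> class_G a b"
    and a_nonneg: "0 \<le> a" and b_nonneg: "0 \<le> b" and R_ge_2: "2 \<le> R"
    and S_finite: "majorizing_S m \<phi> < \<infinity>"
begin

lemma space_m [simp]: "space m = UNIV"
  using sets_eq_imp_space_eq[OF sets_m] by simp

lemma measurable_dist [measurable]:
  "(\<lambda>z. dist (fst z) (snd z)) \<in> borel_measurable (m \<Otimes>\<^sub>M m)"
  using borel_measurable_dist_pair
  unfolding measurable_cong_sets[OF sets_pair_measure_cong[OF sets_m sets_m] refl] .

lemma cball_sets [measurable]: "cball x e \<in> sets m"
  by (simp add: sets_m)

lemma measure_cball_pos:
  assumes "0 < e"
  shows "0 < measure m (cball x e)"
proof -
  have "0 < emeasure m (ball x e)"
  proof -
    have "x \<in> msupport m" by (simp add: support_m)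
    then show ?thesis using assms open_ball[of x e] unfolding msupport_def by simp
  qed
  also have "\<dots> \<le> emeasure m (cball x e)" by (intro emeasure_mono) auto
  finally show ?thesis by (simp add: emeasure_eq_measure)
qed

definition level :: "nat \<Rightarrow> real" where
  "level k = phi_inv \<phi> 1 * R ^ k"

lemma level_0_pos: "0 < phi_inv \<phi> 1"
proof -
  have "phi_inv \<phi> 1 \<noteq> 0" using phi_inv_image(1)[OF \<phi>, of 1] \<phi> unfolding class_G_def by force
  then show ?thesis using phi_inv_image(2)[OF \<phi>, of 1] by simp
qed

lemma level_pos: "0 < level k"
  using level_0_pos R_ge_2 by (simp add: level_def)

lemma level_Suc: "level (Suc k) = R * level k"
  by (simp add: level_def)

lemma level_ge: "phi_inv \<phi> 1 \<le> level k"
proof -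
  have "1 \<le> R ^ k" using R_ge_2 by (intro one_le_power) simp
  then show ?thesis using level_0_pos by (simp add: level_def)
qed

lemma phi_level_ge_1: "1 \<le> \<phi> (level k)"
  using class_G_mono[OF \<phi> _ level_ge[of k]] phi_inv_image[OF \<phi>, of 1] by simp

lemma phi_level_0: "\<phi> (level 0) = 1"
  using phi_inv_image[OF \<phi>, of 1] by (simp add: level_def)

lemma sum_level_le: "(R - 1) * (\<Sum>k<n. level k) \<le> level n"
proof -
  have "(R - 1) * (\<Sum>k<n. level k) = level n - level 0"
    by (induction n) (auto simp: algebra_simps level_Suc)
  then show ?thesis using level_pos[of 0] by simp
qed

lemma level_less_phi_inv:
  assumes "0 < e" "\<phi> (level k) * measure m (cball x e) < 1"
  shows "level k \<le> phi_inv \<phi> (1 / measure m (cball x e))"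
proof (rule ccontr)
  let ?t = "1 / measure m (cball x e)"
  assume "\<not> level k \<le> phi_inv \<phi> ?t"
  then have "\<phi> (phi_inv \<phi> ?t) \<le> \<phi> (level k)"
    using class_G_mono[OF \<phi> phi_inv_image(2)[OF \<phi>]] by simp
  moreover have "\<phi> (phi_inv \<phi> ?t) = ?t" by (intro phi_inv_image(1)[OF \<phi>]) simp
  ultimately show False using assms measure_cball_pos[OF assms(1), of x] by (auto simp: field_simps)
qed

lemma less_ediam:
  assumes "measure m (cball x e) \<noteq> 1" "0 < e"
  shows "ennreal e < ediam TYPE('a)"
proof -
  have "cball x e \<noteq> UNIV" using assms prob_space by auto
  then obtain z where "e < dist x z" unfolding set_eq_iff by (metis UNIV_I mem_cball not_le)
  then have "ennreal e < ennreal (dist x z)" using assms(2) by (intro ennreal_lessI) auto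
  also have "\<dots> \<le> ediam TYPE('a)" unfolding ediam_def by (intro SUP_upper2[of x] SUP_upper2[of z]) auto
  finally show ?thesis .
qed

lemma integral_le_S:
  "(\<integral>\<^sup>+e\<in>{e. 0 < e \<and> ennreal e < ediam TYPE('a)}.
       ennreal (phi_inv \<phi> (1 / measure m (cball x e))) \<partial>lborel) \<le> majorizing_S m \<phi>"
  unfolding majorizing_S_def by (rule SUP_upper) simp

lemma full_ball: "\<exists>e\<ge>0. measure m (cball x e) = 1"
proof (rule ccontr)
  assume neg: "\<not> ?thesis"
  have low: "level 0 \<le> phi_inv \<phi> (1 / measure m (cball x e)) \<and> ennreal e < ediam TYPE('a)" if "0 < e" for e
  proof -
    have "measure m (cball x e) \<noteq> 1" using neg that by (meson less_imp_le)
    moreover from this have "measure m (cball x e) < 1" using prob_le_1[of "cball x e"] by linarith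
    ultimately show ?thesis
      using that less_ediam[of x e] level_less_phi_inv[of e 0 x] by (simp add: phi_level_0)
  qed
  have "(\<integral>\<^sup>+e\<in>{0::real<..}. ennreal (level 0) \<partial>lborel) \<le>
    (\<integral>\<^sup>+e\<in>{e. 0 < e \<and> ennreal e < ediam TYPE('a)}.
       ennreal (phi_inv \<phi> (1 / measure m (cball x e))) \<partial>lborel)"
    using low by (intro nn_integral_mono) (simp add: indicator_def ennreal_leI)
  also have "\<dots> < \<infinity>" using le_less_trans[OF integral_le_S[of x] S_finite] .
  finally have "ennreal (level 0) * emeasure lborel {0::real<..} < \<infinity>"
    by (simp add: nn_integral_cmult_indicator)
  moreover have "emeasure lborel {0::real<..} = \<infinity>"
  proof (rule ccontr)
    assume "emeasure lborel {0::real<..} \<noteq> \<infinity>"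
    then obtain n where n: "emeasure lborel {0::real<..} < of_nat n"
      using ennreal_Ex_less_of_nat by (auto simp: less_top)
    have "ennreal (real (Suc n)) = emeasure lborel {0::real<..<real (Suc n)}" by simp
    also have "\<dots> \<le> emeasure lborel {0::real<..}" by (intro emeasure_mono) auto
    also have "\<dots> \<le> ennreal (real n)" using n by (simp add: ennreal_of_nat_eq_real_of_nat)
    finally show False by simp
  qed
  ultimately show False using level_pos[of 0] by (simp add: ennreal_mult_top)
qed

definition radius :: "nat \<Rightarrow> 'a \<Rightarrow> real" where
  "radius k x = Inf {e. 0 \<le> e \<and> 1 \<le> \<phi> (level k) * measure m (cball x e)}"

lemma radius_set:
  "{e. 0 \<le> e \<and> 1 \<le> \<phi> (level k) * measure m (cball x e)} \<noteq> {}"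
  "bdd_below {e. 0 \<le> e \<and> 1 \<le> \<phi> (level k) * measure m (cball x e)}"
  using full_ball[of x] phi_level_ge_1[of k] by (auto intro!: bdd_belowI[of _ 0])

lemma radius_nonneg: "0 \<le> radius k x"
  unfolding radius_def using radius_set by (intro cInf_greatest) auto

lemma radius_le:
  assumes "0 \<le> e" "1 \<le> \<phi> (level k) * measure m (cball x e)"
  shows "radius k x \<le> e"
  unfolding radius_def using assms radius_set by (intro cInf_lower) auto

lemma measure_cball_radius: "1 \<le> \<phi> (level k) * measure m (cball x (radius k x))"
proof -
  have "(\<lambda>n. measure m (cball x (radius k x + 1 / Suc n))) \<longlonglongrightarrow>
      measure m (\<Inter>n. cball x (radius k x + 1 / Suc n))"
  proof (rule finite_Lim_measure_decseq)
    show "decseq (\<lambda>n. cball x (radius k x + 1 / Suc n))"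
      by (auto simp: decseq_def intro!: subset_cball divide_left_mono)
  qed auto
  moreover have "(\<Inter>n. cball x (radius k x + 1 / Suc n)) = cball x (radius k x)"
  proof
    show "(\<Inter>n. cball x (radius k x + 1 / Suc n)) \<subseteq> cball x (radius k x)"
    proof
      fix z assume z: "z \<in> (\<Inter>n. cball x (radius k x + 1 / Suc n))"
      have "(\<lambda>n. radius k x + 1 / Suc n) \<longlonglongrightarrow> radius k x + 0"
        by (intro tendsto_intros LIMSEQ_Suc[OF lim_1_over_n])
      then have "dist x z \<le> radius k x + 0" by (rule LIMSEQ_le_const) (use z in auto)
      then show "z \<in> cball x (radius k x)" by simp
    qed
    show "cball x (radius k x) \<subseteq> (\<Inter>n. cball x (radius k x + 1 / Suc n))"
      by (intro INT_greatest subset_cball) simp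
  qed
  ultimately have lim: "(\<lambda>n. \<phi> (level k) * measure m (cball x (radius k x + 1 / Suc n))) \<longlonglongrightarrow>
      \<phi> (level k) * measure m (cball x (radius k x))"
    by (auto intro: tendsto_mult)
  have "1 \<le> \<phi> (level k) * measure m (cball x (radius k x + 1 / Suc n))" for n
  proof -
    have "radius k x < radius k x + 1 / Suc n" by simp
    then obtain e where e: "0 \<le> e" "1 \<le> \<phi> (level k) * measure m (cball x e)" "e < radius k x + 1 / Suc n"
      using iffD1[OF cInf_less_iff[OF radius_set, of k x "radius k x + 1 / Suc n"]]
      unfolding radius_def[symmetric] by blast
    have "measure m (cball x e) \<le> measure m (cball x (radius k x + 1 / Suc n))"
      using e by (intro finite_measure_mono subset_cball) auto
    then have "\<phi> (level k) * measure m (cball x e) \<le> \<phi> (level k) * measure m (cball x (radius k x + 1 / Suc n))"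
      using phi_level_ge_1[of k] by (intro mult_left_mono) auto
    then show ?thesis using e(2) by linarith
  qed
  then show ?thesis by (intro LIMSEQ_le_const[OF lim]) auto
qed

lemma radius_lipschitz: "radius k y \<le> radius k x + dist x y"
proof (rule radius_le)
  have "cball x (radius k x) \<subseteq> cball y (radius k x + dist x y)"
  proof
    fix z assume "z \<in> cball x (radius k x)"
    then show "z \<in> cball y (radius k x + dist x y)"
      using dist_triangle[of y z x] by (simp add: dist_commute)
  qed
  then have "measure m (cball x (radius k x)) \<le> measure m (cball y (radius k x + dist x y))"
    by (intro finite_measure_mono) auto
  then have "\<phi> (level k) * measure m (cball x (radius k x)) \<le>
      \<phi> (level k) * measure m (cball y (radius k x + dist x y))"
    using phi_level_ge_1[of k] by (intro mult_left_mono) auto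
  then show "1 \<le> \<phi> (level k) * measure m (cball y (radius k x + dist x y))"
    using measure_cball_radius[of k x] by linarith
qed (use radius_nonneg[of k x] in simp)

lemma measurable_radius [measurable]: "radius k \<in> borel_measurable m"
proof -
  have "continuous_on UNIV (radius k)"
  proof (rule continuous_onI)
    fix x y :: 'a and e :: real assume "e > 0"
    have "dist (radius k y) (radius k x) \<le> dist y x" for y x
      using radius_lipschitz[of k x y] radius_lipschitz[of k y x]
      by (auto simp: dist_real_def dist_commute abs_if)
    then show "\<exists>d>0. \<forall>x'\<in>UNIV. dist x' x < d \<longrightarrow> dist (radius k x') (radius k x) \<le> e"
      using \<open>e > 0\<close> by (meson less_imp_le order_trans)
  qed
  then show ?thesis
    using borel_measurable_continuous_onI measurable_cong_sets[OF sets_m refl] by blast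
qed

lemma sum_level_indicator_le:
  assumes "0 < e"
  shows "(\<Sum>k<n. ennreal ((1 - 1 / R) * level k) * indicator {0<..<radius k x} e) \<le>
    ennreal (phi_inv \<phi> (1 / measure m (cball x e))) *
      indicator {e. 0 < e \<and> ennreal e < ediam TYPE('a)} e"
proof (induction n)
  case (Suc n)
  show ?case
  proof (cases "e < radius n x")
    case True
    then have lt: "\<phi> (level n) * measure m (cball x e) < 1"
      using radius_le[of e n x] assms by (meson not_le less_imp_le)
    then have "measure m (cball x e) \<noteq> 1" using phi_level_ge_1[of n] by auto
    then have ed: "ennreal e < ediam TYPE('a)" by (intro less_ediam assms)
    have "(\<Sum>k<Suc n. ennreal ((1 - 1 / R) * level k) * indicator {0<..<radius k x} e)
        \<le> (\<Sum>k<Suc n. ennreal ((1 - 1 / R) * level k))"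
      by (intro sum_mono) (auto simp: indicator_def)
    also have "\<dots> = ennreal (\<Sum>k<Suc n. (1 - 1 / R) * level k)"
      using R_ge_2 level_pos by (intro sum_ennreal) (auto simp: less_imp_le)
    also have "\<dots> \<le> ennreal (level n)"
    proof (rule ennreal_leI)
      have "(\<Sum>k<Suc n. (1 - 1 / R) * level k) = (R - 1) * (\<Sum>k<Suc n. level k) / R"
        using R_ge_2 unfolding sum_distrib_left[symmetric] by (simp add: field_simps del: sum.lessThan_Suc)
      also have "\<dots> \<le> level (Suc n) / R"
        using R_ge_2 by (intro divide_right_mono sum_level_le) auto
      also have "\<dots> = level n" using R_ge_2 by (simp add: level_Suc)
      finally show "(\<Sum>k<Suc n. (1 - 1 / R) * level k) \<le> level n" .
    qed
    also have "\<dots> \<le> ennreal (phi_inv \<phi> (1 / measure m (cball x e)))"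
      using assms lt by (intro ennreal_leI level_less_phi_inv)
    finally show ?thesis using ed assms by simp
  qed (use Suc in simp)
qed simp

lemma sum_level_radius_le:
  "(\<Sum>k<n. ennreal ((1 - 1 / R) * level k * radius k x)) \<le> majorizing_S m \<phi>"
proof -
  have "(\<Sum>k<n. ennreal ((1 - 1 / R) * level k * radius k x)) =
      (\<integral>\<^sup>+e. (\<Sum>k<n. ennreal ((1 - 1 / R) * level k) * indicator {0<..<radius k x} e) \<partial>lborel)"
    using R_ge_2 level_pos radius_nonneg
    by (subst nn_integral_sum)
      (auto simp: nn_integral_cmult_indicator ennreal_mult[symmetric] less_imp_le intro!: sum.cong)
  also have "\<dots> \<le> (\<integral>\<^sup>+e\<in>{e. 0 < e \<and> ennreal e < ediam TYPE('a)}.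
       ennreal (phi_inv \<phi> (1 / measure m (cball x e))) \<partial>lborel)"
  proof (rule nn_integral_mono)
    fix e :: real
    show "(\<Sum>k<n. ennreal ((1 - 1 / R) * level k) * indicator {0<..<radius k x} e) \<le>
    ennreal (phi_inv \<phi> (1 / measure m (cball x e))) *
      indicator {e. 0 < e \<and> ennreal e < ediam TYPE('a)} e"
      using sum_level_indicator_le[of e] by (cases "0 < e") (auto intro!: sum_nonneg)
  qed
  also have "\<dots> \<le> majorizing_S m \<phi>" by (rule integral_le_S)
  finally show ?thesis .
qed

definition S :: real where "S = enn2real (majorizing_S m \<phi>)"

lemma S_nonneg: "0 \<le> S" by (simp add: S_def)

lemma sum_level_radius_real: "(\<Sum>k<n. level k * radius k x) \<le> R / (R - 1) * S"
proof -
  have "(\<Sum>k<n. ennreal ((1 - 1 / R) * level k * radius k x)) =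
      ennreal (\<Sum>k<n. (1 - 1 / R) * level k * radius k x)"
    using R_ge_2 level_pos radius_nonneg by (intro sum_ennreal) (auto simp: less_imp_le)
  moreover have "ennreal S = majorizing_S m \<phi>" using S_finite by (simp add: S_def less_top)
  ultimately have "(\<Sum>k<n. (1 - 1 / R) * level k * radius k x) \<le> S"
    using sum_level_radius_le[of x n] S_nonneg by (metis ennreal_le_iff)
  then have "(1 - 1 / R) * (\<Sum>k<n. level k * radius k x) \<le> S"
    by (simp add: sum_distrib_left mult.assoc)
  then show ?thesis using R_ge_2 by (simp add: field_simps)
qed

lemma radius_tendsto_0: "(\<lambda>k. radius k x) \<longlonglongrightarrow> 0"
proof -
  have "summable (\<lambda>k. level k * radius k x)"
    using sum_level_radius_real level_pos radius_nonneg
    by (intro bounded_imp_summable[where B = "R / (R - 1) * S"])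
      (auto simp: less_imp_le lessThan_Suc_atMost[symmetric] simp del: sum.lessThan_Suc)
  then have "summable (\<lambda>k. phi_inv \<phi> 1 * radius k x)"
    by (rule summable_comparison_test'[of _ 0])
      (use level_0_pos level_ge radius_nonneg in \<open>auto intro!: mult_right_mono\<close>)
  then have "summable (\<lambda>k. radius k x)" using level_0_pos by simp
  then show ?thesis by (rule summable_LIMSEQ_zero)
qed


subsection \<open>Averages over the chaining balls\<close>

definition kernel :: "nat \<Rightarrow> 'a \<Rightarrow> 'a \<Rightarrow> ennreal" where
  "kernel k x y = indicator (cball x (radius k x)) y / emeasure m (cball x (radius k x))"

lemma cball_radius_pos: "0 < measure m (cball x (radius k x))"
  using measure_cball_radius[of k x] zero_less_measure_iff[of m "cball x (radius k x)"] by force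

lemma measurable_kernel [measurable]:
  "(\<lambda>z. kernel k (fst z) (snd z)) \<in> borel_measurable (m \<Otimes>\<^sub>M m)"
proof -
  have Q: "{z. dist (fst z) (snd z) \<le> radius k (fst z)} \<in> sets (m \<Otimes>\<^sub>M m)"
  proof -
    have "{z \<in> space (m \<Otimes>\<^sub>M m). dist (fst z) (snd z) \<le> radius k (fst z)} \<in> sets (m \<Otimes>\<^sub>M m)"
      by measurable
    then show ?thesis by (simp add: space_pair_measure)
  qed
  have eq: "cball x (radius k x) = Pair x -` {z. dist (fst z) (snd z) \<le> radius k (fst z)}" for x
    by auto
  have [measurable]: "(\<lambda>x. emeasure m (cball x (radius k x))) \<in> borel_measurable m"
    unfolding eq using measurable_emeasure_Pair[OF Q] .
  have "(\<lambda>z. indicator {z. dist (fst z) (snd z) \<le> radius k (fst z)} z /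
      emeasure m (cball (fst z) (radius k (fst z)))) \<in> borel_measurable (m \<Otimes>\<^sub>M m)"
    using Q by measurable
  then show ?thesis by (simp add: kernel_def indicator_def)
qed

lemma measurable_kernel_right [measurable]: "kernel k x \<in> borel_measurable m"
  using measurable_compose[OF measurable_Pair1' measurable_kernel, of x] by simp

lemma kernel_mass: "(\<integral>\<^sup>+y. kernel k x y \<partial>m) = 1"
proof -
  have "(\<integral>\<^sup>+y. kernel k x y \<partial>m) = emeasure m (cball x (radius k x)) / emeasure m (cball x (radius k x))"
    unfolding kernel_def by (simp add: nn_integral_divide)
  also have "\<dots> = 1"
    using cball_radius_pos[of x k] by (intro ennreal_divide_self) (auto simp: emeasure_eq_measure)
  finally show ?thesis .
qed

lemma kernel_le: "kernel k x y \<le> ennreal (\<phi> (level k))"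
proof -
  have "kernel k x y \<le> 1 / emeasure m (cball x (radius k x))"
    unfolding kernel_def by (intro divide_right_mono_ennreal) (auto simp: indicator_def)
  also have "\<dots> = ennreal (1 / measure m (cball x (radius k x)))"
    using cball_radius_pos[of x k] by (simp add: emeasure_eq_measure divide_ennreal flip: ennreal_1)
  also have "\<dots> \<le> ennreal (\<phi> (level k))"
    using cball_radius_pos[of x k] measure_cball_radius[of k x]
    by (intro ennreal_leI) (simp add: field_simps)
  finally show ?thesis .
qed

lemma kernel_eq_0: "\<not> dist x y \<le> radius k x \<Longrightarrow> kernel k x y = 0"
  by (simp add: kernel_def)

definition avg :: "nat \<Rightarrow> ('a \<Rightarrow> ennreal) \<Rightarrow> 'a \<Rightarrow> ennreal" where
  "avg k g x = (\<integral>\<^sup>+y. kernel k x y * g y \<partial>m)"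

lemma avg_mono:
  assumes "\<And>y. dist x y \<le> radius k x \<Longrightarrow> g y \<le> h y"
  shows "avg k g x \<le> avg k h x"
  unfolding avg_def
proof (rule nn_integral_mono)
  fix y show "kernel k x y * g y \<le> kernel k x y * h y"
    using assms kernel_eq_0 by (cases "dist x y \<le> radius k x") (auto intro!: mult_left_mono)
qed

lemma avg_const: "avg k (\<lambda>_. C) x = C"
  unfolding avg_def by (simp add: nn_integral_multc kernel_mass)

lemma avg_add:
  assumes [measurable]: "g \<in> borel_measurable m" "h \<in> borel_measurable m"
  shows "avg k (\<lambda>y. g y + h y) x = avg k g x + avg k h x"
  unfolding avg_def by (simp add: distrib_left nn_integral_add)

lemma avg_cmult:
  assumes [measurable]: "g \<in> borel_measurable m"
  shows "avg k (\<lambda>y. C * g y) x = C * avg k g x"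
  unfolding avg_def by (simp add: mult.left_commute nn_integral_cmult)

lemma avg_le_integral:
  assumes [measurable]: "g \<in> borel_measurable m"
  shows "avg k g x \<le> ennreal (\<phi> (level k)) * (\<integral>\<^sup>+y. g y \<partial>m)"
proof -
  have "avg k g x \<le> (\<integral>\<^sup>+y. ennreal (\<phi> (level k)) * g y \<partial>m)"
    unfolding avg_def by (intro nn_integral_mono mult_right_mono kernel_le) simp
  then show ?thesis by (simp add: nn_integral_cmult)
qed

lemma measurable_avg:
  assumes [measurable]: "(\<lambda>z. g (fst z) (snd z)) \<in> borel_measurable (m \<Otimes>\<^sub>M m)"
  shows "(\<lambda>x. avg k (g x) x) \<in> borel_measurable m"
proof -
  have "(\<lambda>z. kernel k (fst z) (snd z) * g (fst z) (snd z)) \<in> borel_measurable (m \<Otimes>\<^sub>M m)"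
    by measurable
  then have "(\<lambda>x. \<integral>\<^sup>+y. kernel k (fst (x, y)) (snd (x, y)) * g (fst (x, y)) (snd (x, y)) \<partial>m)
      \<in> borel_measurable m"
    by (rule borel_measurable_nn_integral_fst)
  then show ?thesis by (simp add: avg_def)
qed

definition osc :: "('a \<Rightarrow> real) \<Rightarrow> 'a \<Rightarrow> ennreal" where
  "osc f x = (\<integral>\<^sup>+y. ennreal \<bar>f x - f y\<bar> \<partial>m)"

lemma measurable_osc [measurable]:
  assumes [measurable]: "f \<in> borel_measurable m"
  shows "osc f \<in> borel_measurable m"
  unfolding osc_def by measurable

lemma osc_triangle:
  assumes [measurable]: "f \<in> borel_measurable m"
  shows "osc f x \<le> ennreal \<bar>f x - f y\<bar> + osc f y"
proof -
  have "osc f x \<le> (\<integral>\<^sup>+z. ennreal \<bar>f x - f y\<bar> + ennreal \<bar>f y - f z\<bar> \<partial>m)"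
    unfolding osc_def by (intro nn_integral_mono) (auto simp flip: ennreal_plus intro!: ennreal_leI)
  also have "\<dots> = ennreal \<bar>f x - f y\<bar> + osc f y"
    unfolding osc_def by (subst nn_integral_add) (auto simp: emeasure_space_1[simplified])
  finally show ?thesis .
qed

lemma osc_sum:
  assumes [measurable]: "f \<in> borel_measurable m"
  shows "ennreal \<bar>f x - f y\<bar> \<le> osc f x + osc f y"
proof -
  have "ennreal \<bar>f x - f y\<bar> = (\<integral>\<^sup>+z. ennreal \<bar>f x - f y\<bar> \<partial>m)"
    by (simp add: emeasure_space_1[simplified])
  also have "\<dots> \<le> (\<integral>\<^sup>+z. ennreal \<bar>f x - f z\<bar> + ennreal \<bar>f y - f z\<bar> \<partial>m)"
    by (intro nn_integral_mono) (auto simp flip: ennreal_plus intro!: ennreal_leI)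
  also have "\<dots> = osc f x + osc f y"
    unfolding osc_def by (subst nn_integral_add) auto
  finally show ?thesis .
qed

text \<open>
  Level 0 is set to 0 because \<open>avg 0 (osc f)\<close> does not vanish, while the balls of level 0 have full
  measure, so that \<open>osc_le_avg\<close> holds there without a remainder.
\<close>

definition avg_osc :: "('a \<Rightarrow> real) \<Rightarrow> nat \<Rightarrow> 'a \<Rightarrow> ennreal" where
  "avg_osc f k x = (if k = 0 then 0 else avg k (osc f) x)"

lemma osc_le_avg:
  assumes [measurable]: "f \<in> borel_measurable m"
  shows "osc f x \<le> avg k (\<lambda>y. ennreal \<bar>f x - f y\<bar>) x + avg_osc f k x"
proof (cases "k = 0")
  case True
  have "measure m (cball x (radius 0 x)) = 1"
    using measure_cball_radius[of 0 x] prob_le_1[of "cball x (radius 0 x)"]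
    by (simp add: phi_level_0)
  then have "AE y in m. kernel 0 x y = 1"
    using AE_prob_1[of "cball x (radius 0 x)"]
    by (auto simp: kernel_def emeasure_eq_measure indicator_def divide_ennreal simp flip: ennreal_1)
  then have "osc f x \<le> avg 0 (\<lambda>y. ennreal \<bar>f x - f y\<bar>) x"
    unfolding osc_def avg_def by (intro nn_integral_mono_AE) auto
  then show ?thesis by (simp add: True avg_osc_def)
next
  case False
  have "osc f x = avg k (\<lambda>_. osc f x) x" by (simp add: avg_const)
  also have "\<dots> \<le> avg k (\<lambda>y. ennreal \<bar>f x - f y\<bar> + osc f y) x"
    by (intro avg_mono osc_triangle) simp
  also have "\<dots> = avg k (\<lambda>y. ennreal \<bar>f x - f y\<bar>) x + avg k (osc f) x"
    by (intro avg_add) auto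
  finally show ?thesis by (simp add: False avg_osc_def)
qed

lemma increment_bound:
  "\<bar>f u - f v\<bar> \<le> dist u v * level k * (a + b * (\<phi> (\<bar>f u - f v\<bar> / dist u v) / \<phi> (level k)))"
proof (cases "u = v")
  case False
  let ?g = "\<bar>f u - f v\<bar> / dist u v"
  have "\<forall>x\<ge>0. \<forall>y\<ge>phi_inv \<phi> 1. x \<le> a + b * (\<phi> (x * y) / \<phi> y)"
    using \<phi> unfolding class_G_def by simp
  moreover have "0 \<le> ?g / level k" using level_pos[of k] by simp
  ultimately have "?g / level k \<le> a + b * (\<phi> (?g / level k * level k) / \<phi> (level k))"
    using level_ge[of k] by blast
  then have "?g \<le> level k * (a + b * (\<phi> ?g / \<phi> (level k)))"
    using level_pos[of k] unfolding pos_divide_le_eq[OF level_pos] by (simp add: mult.commute)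
  then have "dist u v * ?g \<le> dist u v * (level k * (a + b * (\<phi> ?g / \<phi> (level k))))"
    by (intro mult_left_mono) auto
  then show ?thesis using False by (simp add: mult.assoc)
qed simp

definition slope :: "('a \<Rightarrow> real) \<Rightarrow> 'a \<Rightarrow> 'a \<Rightarrow> ennreal" where
  "slope f u v = ennreal (\<phi> (\<bar>f u - f v\<bar> / dist u v))"

lemma measurable_phi_abs [measurable]: "(\<lambda>x. \<phi> \<bar>x\<bar>) \<in> borel_measurable borel"
proof (rule borel_measurable_continuous_onI)
  have "continuous_on {0..} \<phi>" using \<phi> unfolding class_G_def by simp
  then show "continuous_on UNIV (\<lambda>x. \<phi> \<bar>x\<bar>)"
    by (rule continuous_on_compose2) (auto intro!: continuous_intros)
qed

lemma slope_eq: "slope f u v = ennreal (\<phi> \<bar>(f u - f v) / dist u v\<bar>)"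
  by (simp add: slope_def)

lemma measurable_slope [measurable]:
  assumes [measurable]: "f \<in> borel_measurable m"
  shows "(\<lambda>z. slope f (fst z) (snd z)) \<in> borel_measurable (m \<Otimes>\<^sub>M m)"
  unfolding slope_eq by measurable

lemma measurable_slope_right [measurable]:
  assumes "f \<in> borel_measurable m"
  shows "slope f u \<in> borel_measurable m"
  using measurable_compose[OF measurable_Pair1' measurable_slope[OF assms], of u] by simp

lemma avg_increment_le:
  assumes [measurable]: "f \<in> borel_measurable m"
  shows "avg k (\<lambda>v. ennreal \<bar>f u - f v\<bar>) u \<le> ennreal (a * (level (Suc k) * radius k u)) +
    ennreal (b * level (Suc k) / \<phi> (level (Suc k)) * radius k u) * avg k (slope f u) u"
proof -
  let ?y = "level (Suc k)"
  have "ennreal \<bar>f u - f v\<bar> \<le> ennreal (a * (?y * radius k u)) +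
      ennreal (b * ?y / \<phi> ?y * radius k u) * slope f u v" if "dist u v \<le> radius k u" for v
  proof -
    let ?p = "\<phi> (\<bar>f u - f v\<bar> / dist u v)"
    have p: "0 \<le> ?p" by (intro class_G_nonneg[OF \<phi>]) simp
    have y: "0 < ?y" "1 \<le> \<phi> ?y" by (rule level_pos, rule phi_level_ge_1)
    have c: "0 \<le> b * ?y / \<phi> ?y * radius k u" using b_nonneg y radius_nonneg[of k u] by simp
    have "\<bar>f u - f v\<bar> \<le> dist u v * ?y * (a + b * (?p / \<phi> ?y))" by (rule increment_bound)
    also have "\<dots> \<le> radius k u * ?y * (a + b * (?p / \<phi> ?y))"
      using that y p a_nonneg b_nonneg by (intro mult_right_mono) auto
    also have "\<dots> = a * (?y * radius k u) + b * ?y / \<phi> ?y * radius k u * ?p"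
      using y by (simp add: field_simps)
    finally have "ennreal \<bar>f u - f v\<bar> \<le> ennreal (a * (?y * radius k u) + b * ?y / \<phi> ?y * radius k u * ?p)"
      by (rule ennreal_leI)
    also have "\<dots> = ennreal (a * (?y * radius k u)) + ennreal (b * ?y / \<phi> ?y * radius k u) * slope f u v"
      using a_nonneg y radius_nonneg[of k u] c p
      unfolding slope_def ennreal_mult[OF c p, symmetric] by (intro ennreal_plus mult_nonneg_nonneg[OF c p]) simp
    finally show ?thesis .
  qed
  then have "avg k (\<lambda>v. ennreal \<bar>f u - f v\<bar>) u \<le> avg k (\<lambda>v. ennreal (a * (?y * radius k u)) +
      ennreal (b * ?y / \<phi> ?y * radius k u) * slope f u v) u"
    by (intro avg_mono)
  then show ?thesis by (simp add: avg_add avg_cmult avg_const)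
qed

definition weight :: "'a \<Rightarrow> 'a \<Rightarrow> ennreal" where
  "weight u v = (\<Sum>k. ennreal (level (Suc k) * radius k u) * kernel k u v)"

lemma measurable_weight [measurable]:
  "(\<lambda>z. weight (fst z) (snd z)) \<in> borel_measurable (m \<Otimes>\<^sub>M m)"
  unfolding weight_def by measurable

lemma measurable_weight_right [measurable]: "weight u \<in> borel_measurable m"
  using measurable_compose[OF measurable_Pair1' measurable_weight, of u] by simp

lemma weight_mass: "(\<integral>\<^sup>+u. \<integral>\<^sup>+v. weight u v \<partial>m \<partial>m) \<le> ennreal (R ^ 2 / (R - 1) * S)"
proof -
  have "(\<integral>\<^sup>+v. weight u v \<partial>m) \<le> ennreal (R ^ 2 / (R - 1) * S)" for u
  proof -
    have "(\<integral>\<^sup>+v. weight u v \<partial>m) = (\<Sum>k. ennreal (level (Suc k) * radius k u))"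
      unfolding weight_def by (subst nn_integral_suminf) (auto simp: nn_integral_cmult kernel_mass)
    also have "\<dots> \<le> ennreal (R ^ 2 / (R - 1) * S)"
    proof (rule suminf_le_const)
      fix n
      have "(\<Sum>k<n. ennreal (level (Suc k) * radius k u)) = ennreal (\<Sum>k<n. level (Suc k) * radius k u)"
        using level_pos radius_nonneg by (intro sum_ennreal) (auto simp: less_imp_le)
      also have "(\<Sum>k<n. level (Suc k) * radius k u) = R * (\<Sum>k<n. level k * radius k u)"
        by (simp add: level_Suc sum_distrib_left mult.assoc)
      also have "ennreal \<dots> \<le> ennreal (R * (R / (R - 1) * S))"
        using R_ge_2 by (intro ennreal_leI mult_left_mono sum_level_radius_real) auto
      finally show "(\<Sum>k<n. ennreal (level (Suc k) * radius k u)) \<le> ennreal (R ^ 2 / (R - 1) * S)"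
        by (simp add: power2_eq_square mult.assoc)
    qed simp
    finally show ?thesis .
  qed
  then have "(\<integral>\<^sup>+u. \<integral>\<^sup>+v. weight u v \<partial>m \<partial>m) \<le> (\<integral>\<^sup>+u. ennreal (R ^ 2 / (R - 1) * S) \<partial>m)"
    by (intro nn_integral_mono)
  then show ?thesis by (simp add: emeasure_space_1[simplified])
qed

definition energy :: "nat \<Rightarrow> ('a \<Rightarrow> real) \<Rightarrow> ennreal" where
  "energy k f = (\<integral>\<^sup>+u. ennreal (level (Suc k) * radius k u) * avg k (slope f u) u \<partial>m)"

lemma sum_energy_le:
  assumes [measurable]: "f \<in> borel_measurable m"
  shows "(\<Sum>k<n. energy k f) \<le> (\<integral>\<^sup>+u. \<integral>\<^sup>+v. weight u v * slope f u v \<partial>m \<partial>m)"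
proof -
  have [measurable]: "(\<lambda>u. avg k (slope f u) u) \<in> borel_measurable m" for k
    by (intro measurable_avg) measurable
  have "(\<Sum>k<n. energy k f) = (\<integral>\<^sup>+u. (\<Sum>k<n. ennreal (level (Suc k) * radius k u) * avg k (slope f u) u) \<partial>m)"
    unfolding energy_def by (intro nn_integral_sum[symmetric]) measurable
  also have "\<dots> = (\<integral>\<^sup>+u. \<integral>\<^sup>+v. (\<Sum>k<n. ennreal (level (Suc k) * radius k u) * kernel k u v) * slope f u v \<partial>m \<partial>m)"
    unfolding avg_def sum_distrib_right
    by (intro nn_integral_cong) (simp add: nn_integral_sum nn_integral_cmult mult.assoc)
  also have "\<dots> \<le> (\<integral>\<^sup>+u. \<integral>\<^sup>+v. weight u v * slope f u v \<partial>m \<partial>m)"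
    unfolding weight_def by (intro nn_integral_mono mult_right_mono sum_le_suminf) auto
  finally show ?thesis .
qed

definition drift :: "nat \<Rightarrow> 'a \<Rightarrow> real" where
  "drift k x = R * (R - 1) / (R - 2) * (\<Sum>j<k. level j * radius j x) + R / (R - 2) * (level k * radius k x)"

lemma drift_nonneg: "0 \<le> drift k x"
  unfolding drift_def using R_ge_2 level_pos radius_nonneg
  by (intro add_nonneg_nonneg mult_nonneg_nonneg sum_nonneg divide_nonneg_nonneg) (auto simp: less_imp_le)

text \<open>
  With \<open>\<kappa> = R (R - 1) / (R - 2)\<close> and \<open>\<mu> = R / (R - 2)\<close>, the coefficients of \<open>drift\<close> solve
  \<open>R + \<mu> = \<kappa>\<close> and \<open>R + 2 \<mu> = \<mu> R\<close>. For \<open>R = 2\<close> both are the junk value 0; then \<open>a = 0\<close> whenever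
  \<open>drift\<close> is used.
\<close>

lemma drift_Suc:
  assumes "2 < R" "dist x y \<le> radius (Suc k) x"
  shows "level (Suc k) * radius k y + drift k y \<le> drift (Suc k) x"
proof -
  define t where "t = radius (Suc k) x"
  define \<kappa> \<mu> where "\<kappa> = R * (R - 1) / (R - 2)" and "\<mu> = R / (R - 2)"
  have \<kappa>\<mu>: "\<kappa> = \<mu> * (R - 1)" "R + \<mu> = \<kappa>" "R + 2 * \<mu> = \<mu> * R" "0 \<le> \<kappa>" "0 \<le> \<mu>"
    using assms(1) by (auto simp: \<kappa>_def \<mu>_def field_simps)
  have r: "radius j y \<le> radius j x + t" for j
    using radius_lipschitz[of j y x] assms(2) by (simp add: t_def)
  have t: "0 \<le> t" by (simp add: t_def radius_nonneg)
  have lr: "level i * radius j y \<le> level i * radius j x + level i * t" for i j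
    using mult_left_mono[OF r[of j], of "level i"] level_pos[of i] by (simp add: distrib_left)
  have "\<kappa> * (\<Sum>j<k. level j * radius j y) \<le> \<kappa> * (\<Sum>j<k. level j * radius j x + level j * t)"
    by (intro mult_left_mono sum_mono lr \<kappa>\<mu>)
  also have "\<dots> = \<kappa> * (\<Sum>j<k. level j * radius j x) + \<mu> * ((R - 1) * (\<Sum>j<k. level j)) * t"
    by (simp add: \<kappa>\<mu>(1) sum.distrib sum_distrib_right[symmetric] distrib_left mult.assoc)
  also have "\<dots> \<le> \<kappa> * (\<Sum>j<k. level j * radius j x) + \<mu> * level k * t"
    using sum_level_le[of k] t \<kappa>\<mu> by (intro add_left_mono mult_right_mono mult_left_mono) auto
  finally have 1: "\<kappa> * (\<Sum>j<k. level j * radius j y) \<le> \<kappa> * (\<Sum>j<k. level j * radius j x) + \<mu> * level k * t" .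
  have 2: "level (Suc k) * radius k y \<le> R * (level k * radius k x) + R * (level k * t)"
    using lr[of "Suc k" k] by (simp add: level_Suc mult.assoc)
  have 3: "\<mu> * (level k * radius k y) \<le> \<mu> * (level k * radius k x) + \<mu> * (level k * t)"
    using mult_left_mono[OF lr[of k k] \<kappa>\<mu>(5)] by (simp add: distrib_left)
  have "level (Suc k) * radius k y + drift k y \<le>
      \<kappa> * (\<Sum>j<k. level j * radius j x) + (R + \<mu>) * (level k * radius k x) + (R + 2 * \<mu>) * (level k * t)"
    using 1 2 3 unfolding drift_def \<kappa>_def[symmetric] \<mu>_def[symmetric] by (simp add: algebra_simps)
  also have "\<dots> = drift (Suc k) x"
    unfolding drift_def \<kappa>_def[symmetric] \<mu>_def[symmetric] \<kappa>\<mu>(2,3) t_def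
    by (simp add: algebra_simps level_Suc)
  finally show ?thesis .
qed

lemma drift_le:
  assumes "2 < R"
  shows "drift k x \<le> R ^ 3 / ((R - 1) * (R - 2)) * S"
proof -
  have "R / (R - 2) * (level k * radius k x) \<le> R * (R - 1) / (R - 2) * (level k * radius k x)"
    using assms level_pos[of k] radius_nonneg[of k x]
    by (intro mult_right_mono divide_right_mono) auto
  then have "drift k x \<le> R * (R - 1) / (R - 2) * (\<Sum>j<Suc k. level j * radius j x)"
    unfolding drift_def by (simp add: distrib_left)
  also have "\<dots> \<le> R * (R - 1) / (R - 2) * (R / (R - 1) * S)"
    using assms by (intro mult_left_mono sum_level_radius_real) auto
  also have "\<dots> = R ^ 2 / (R - 2) * S"
    using assms by (simp add: power2_eq_square)
  also have "R ^ 2 / (R - 2) = R ^ 2 * (R - 1) / ((R - 1) * (R - 2))" using assms by simp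
  also have "\<dots> * S \<le> R ^ 3 / ((R - 1) * (R - 2)) * S"
    using assms S_nonneg
    by (intro mult_right_mono divide_right_mono) (auto simp: power2_eq_square power3_eq_cube)
  finally show ?thesis .
qed

lemma avg_osc_le:
  assumes [measurable]: "f \<in> borel_measurable m" and "a = 0 \<or> 2 < R"
  shows "avg_osc f k x \<le> ennreal (a * drift k x) + ennreal b * (\<Sum>j<k. energy j f)"
proof (induction k arbitrary: x)
  case (Suc k)
  let ?y = "level (Suc k)"
  let ?C = "ennreal b * (\<Sum>j<k. energy j f)"
  define g where "g u = ennreal (b / \<phi> ?y) * (ennreal (?y * radius k u) * avg k (slope f u) u)" for u
  have [measurable]: "(\<lambda>u. avg k (slope f u) u) \<in> borel_measurable m" for k
    by (intro measurable_avg) measurable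
  have g [measurable]: "g \<in> borel_measurable m" unfolding g_def by measurable
  have N: "1 \<le> \<phi> ?y" by (rule phi_level_ge_1)
  have "osc f u \<le> (ennreal (a * drift (Suc k) x) + ?C) + g u" if u: "dist x u \<le> radius (Suc k) x" for u
  proof -
    have "osc f u \<le> avg k (\<lambda>v. ennreal \<bar>f u - f v\<bar>) u + avg_osc f k u"
      by (rule osc_le_avg) measurable
    also have "\<dots> \<le> (ennreal (a * (?y * radius k u)) +
        ennreal (b * ?y / \<phi> ?y * radius k u) * avg k (slope f u) u) + (ennreal (a * drift k u) + ?C)"
      by (intro add_mono avg_increment_le Suc.IH) measurable
    also have "ennreal (b * ?y / \<phi> ?y * radius k u) = ennreal (b / \<phi> ?y) * ennreal (?y * radius k u)"
      using b_nonneg N level_pos[of "Suc k"] radius_nonneg[of k u]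
      by (subst ennreal_mult[symmetric]) auto
    also have "(ennreal (a * (?y * radius k u)) +
        ennreal (b / \<phi> ?y) * ennreal (?y * radius k u) * avg k (slope f u) u) + (ennreal (a * drift k u) + ?C)
        = (ennreal (a * (?y * radius k u)) + ennreal (a * drift k u)) + ?C + g u"
      by (simp add: g_def ac_simps)
    also have "ennreal (a * (?y * radius k u)) + ennreal (a * drift k u) =
        ennreal (a * (?y * radius k u + drift k u))"
      using a_nonneg level_pos[of "Suc k"] radius_nonneg[of k u] drift_nonneg[of k u]
      by (subst ennreal_plus[symmetric]) (auto simp: distrib_left)
    also have "\<dots> + ?C + g u \<le> ennreal (a * drift (Suc k) x) + ?C + g u"
    proof (intro add_right_mono ennreal_leI)
      show "a * (?y * radius k u + drift k u) \<le> a * drift (Suc k) x"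
        using assms(2) drift_Suc[OF _ u] a_nonneg mult_left_mono by fastforce
    qed
    finally show ?thesis .
  qed
  then have "avg (Suc k) (osc f) x \<le> avg (Suc k) (\<lambda>u. (ennreal (a * drift (Suc k) x) + ?C) + g u) x"
    by (intro avg_mono)
  also have "\<dots> = (ennreal (a * drift (Suc k) x) + ?C) + avg (Suc k) g x"
    by (simp add: avg_add avg_const)
  also have "avg (Suc k) g x \<le> ennreal b * energy k f"
  proof -
    have "avg (Suc k) g x \<le> ennreal (\<phi> ?y) * (\<integral>\<^sup>+u. g u \<partial>m)"
      by (rule avg_le_integral) measurable
    also have "(\<integral>\<^sup>+u. g u \<partial>m) = ennreal (b / \<phi> ?y) * energy k f"
      unfolding g_def energy_def by (simp add: nn_integral_cmult)
    also have "ennreal (\<phi> ?y) * (ennreal (b / \<phi> ?y) * energy k f) = ennreal b * energy k f"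
      using N b_nonneg by (simp add: mult.assoc[symmetric] ennreal_mult[symmetric])
    finally show ?thesis .
  qed
  finally show ?case by (simp add: avg_osc_def distrib_left ac_simps)
qed (simp add: avg_osc_def)

lemma osc_le:
  assumes f [measurable]: "f \<in> borel_measurable m" and R: "a = 0 \<or> 2 < R"
    and lim: "(INF k. avg k (\<lambda>y. ennreal \<bar>f x - f y\<bar>) x) = 0"
  shows "osc f x \<le> ennreal (a * (R ^ 3 / ((R - 1) * (R - 2)) * S)) +
    ennreal b * (\<integral>\<^sup>+u. \<integral>\<^sup>+v. weight u v * slope f u v \<partial>m \<partial>m)"
proof (rule ennreal_le_epsilon)
  fix e :: real assume "0 < e"
  then have "(INF k. avg k (\<lambda>y. ennreal \<bar>f x - f y\<bar>) x) < ennreal e" by (simp add: lim)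
  then obtain k where k: "avg k (\<lambda>y. ennreal \<bar>f x - f y\<bar>) x < ennreal e"
    unfolding INF_less_iff by auto
  have "a * drift k x \<le> a * (R ^ 3 / ((R - 1) * (R - 2)) * S)"
    using R mult_left_mono[OF drift_le[of k x] a_nonneg] by auto
  then have "avg_osc f k x \<le> ennreal (a * (R ^ 3 / ((R - 1) * (R - 2)) * S)) +
    ennreal b * (\<integral>\<^sup>+u. \<integral>\<^sup>+v. weight u v * slope f u v \<partial>m \<partial>m)"
    by (intro order_trans[OF avg_osc_le[OF f R]] add_mono ennreal_leI mult_left_mono[of "sum _ _"]
      sum_energy_le f) auto
  then show "osc f x \<le> ennreal (a * (R ^ 3 / ((R - 1) * (R - 2)) * S)) +
    ennreal b * (\<integral>\<^sup>+u. \<integral>\<^sup>+v. weight u v * slope f u v \<partial>m \<partial>m) + ennreal e"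
    using osc_le_avg[OF f, of x k] k
    by (subst add.commute) (meson add_mono less_imp_le order_trans)
qed

end

section \<open>Processes with bounded increments\<close>

lemma (in dense_metric) measurable_modification:
  fixes X :: "'a \<Rightarrow> 'w \<Rightarrow> real"
  assumes X [measurable]: "\<And>t. X t \<in> borel_measurable M"
    and L: "\<And>s t. (\<integral>\<^sup>+\<omega>. ennreal \<bar>X s \<omega> - X t \<omega>\<bar> \<partial>M) \<le> ennreal (L * dist s t)" and "0 \<le> L"
  obtains Y where "(\<lambda>z. Y (fst z) (snd z)) \<in> borel_measurable (borel \<Otimes>\<^sub>M M)"
    and "\<And>t. AE \<omega> in M. Y t \<omega> = X t \<omega>"
proof
  define Y where "Y t \<omega> = lim (\<lambda>n. X (c (q n t)) \<omega>)" for t \<omega>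
  have "(\<lambda>z. X (c (q n (fst z))) (snd z)) \<in> borel_measurable (borel \<Otimes>\<^sub>M M)" for n
    by (rule measurable_compose_countable[where f = "\<lambda>i z. X (c i) (snd z)" and g = "\<lambda>z. q n (fst z)"])
      measurable
  then show "(\<lambda>z. Y (fst z) (snd z)) \<in> borel_measurable (borel \<Otimes>\<^sub>M M)"
    unfolding Y_def by (rule borel_measurable_lim_metric)
  fix t
  have "(\<integral>\<^sup>+\<omega>. (\<Sum>n. ennreal \<bar>X (c (q n t)) \<omega> - X t \<omega>\<bar>) \<partial>M) =
      (\<Sum>n. \<integral>\<^sup>+\<omega>. ennreal \<bar>X (c (q n t)) \<omega> - X t \<omega>\<bar> \<partial>M)"
    by (rule nn_integral_suminf) measurable
  also have "\<dots> \<le> (\<Sum>n. ennreal (L * (1 / 2) ^ n))"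
  proof (rule suminf_le)
    fix n
    have "ennreal (L * dist (c (q n t)) t) \<le> ennreal (L * (1 / 2) ^ n)"
      using dist_q[of t n] \<open>0 \<le> L\<close>
      by (intro ennreal_leI mult_left_mono) (auto simp: dist_commute)
    then show "(\<integral>\<^sup>+\<omega>. ennreal \<bar>X (c (q n t)) \<omega> - X t \<omega>\<bar> \<partial>M) \<le> ennreal (L * (1 / 2) ^ n)"
      using L[of "c (q n t)" t] by (rule order_trans[rotated])
  qed auto
  also have "\<dots> < \<infinity>"
    using \<open>0 \<le> L\<close> by (subst suminf_ennreal2) (auto intro!: summable_mult complete_algebra_summable_geometric)
  finally have "AE \<omega> in M. (\<Sum>n. ennreal \<bar>X (c (q n t)) \<omega> - X t \<omega>\<bar>) \<noteq> \<infinity>"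
    by (intro nn_integral_PInf_AE borel_measurable_suminf measurable_compose[OF _ measurable_ennreal])
      simp_all
  then show "AE \<omega> in M. Y t \<omega> = X t \<omega>"
  proof eventually_elim
    fix \<omega> assume "(\<Sum>n. ennreal \<bar>X (c (q n t)) \<omega> - X t \<omega>\<bar>) \<noteq> \<infinity>"
    then have "summable (\<lambda>n. \<bar>X (c (q n t)) \<omega> - X t \<omega>\<bar>)"
      by (intro summable_suminf_not_top) auto
    then have "(\<lambda>n. X (c (q n t)) \<omega> - X t \<omega>) \<longlonglongrightarrow> 0"
      using summable_LIMSEQ_zero tendsto_rabs_zero_iff by blast
    then have "(\<lambda>n. X (c (q n t)) \<omega>) \<longlonglongrightarrow> X t \<omega>"
      by (simp add: LIM_zero_iff)
    then show "Y t \<omega> = X t \<omega>" unfolding Y_def by (rule limI)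
  qed
qed

context majorizing_chain
begin

lemma psi_le_energy:
  assumes f [measurable]: "f \<in> borel_measurable m" and R: "a = 0 \<or> 2 < R"
    and lim: "(INF k. avg k (\<lambda>y. ennreal \<bar>f s - f y\<bar>) s) = 0"
      "(INF k. avg k (\<lambda>y. ennreal \<bar>f t - f y\<bar>) t) = 0"
    and K: "K = (a * (R ^ 3 / ((R - 1) * (R - 2))) + b * (R ^ 2 / (R - 1))) * S"
    and S: "0 < S"
    and \<psi>: "\<psi> 0 = 0" "\<And>x y. x \<ge> 0 \<Longrightarrow> y > 0 \<Longrightarrow> \<psi> x \<le> \<alpha> + \<beta> * (\<phi> (x * y) / \<phi> y)"
    and "0 \<le> \<alpha>" "0 \<le> \<beta>"
  shows "ennreal (\<psi> (\<bar>f s - f t\<bar> / (2 * K))) \<le> ennreal \<alpha> + ennreal \<beta> *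
    (\<integral>\<^sup>+u. \<integral>\<^sup>+v. weight u v * slope f u v \<partial>m \<partial>m) / ennreal (R ^ 2 / (R - 1) * S)"
proof -
  define A' B' where "A' = R ^ 3 / ((R - 1) * (R - 2))" and "B' = R ^ 2 / (R - 1)"
  define z where "z = \<bar>f s - f t\<bar> / (2 * K)"
  let ?J = "\<lambda>g. \<integral>\<^sup>+u. \<integral>\<^sup>+v. weight u v * slope g u v \<partial>m \<partial>m"
  have b: "0 < b" by (rule class_G_b_pos[OF \<phi> a_nonneg b_nonneg])
  have A': "0 \<le> a * A'" using R a_nonneg by (auto simp: A'_def)
  have B': "0 < B'" using R_ge_2 by (simp add: B'_def)
  have K': "K = a * (A' * S) + b * (B' * S)" by (simp add: K A'_def B'_def algebra_simps)
  have K_pos: "0 < K" unfolding K'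
    using A' B' b S by (intro add_nonneg_pos) (auto simp flip: mult.assoc)
  show ?thesis
  proof (cases "z = 0 \<or> \<psi> z \<le> \<alpha>")
    case True
    then have "\<psi> z \<le> \<alpha>" using \<psi>(1) \<open>0 \<le> \<alpha>\<close> by auto
    then have "ennreal (\<psi> z) \<le> ennreal \<alpha>" by (rule ennreal_leI)
    then show ?thesis unfolding z_def by (rule order_trans) simp
  next
    case False
    then have z: "0 < z" using K_pos by (auto simp: z_def less_le)
    define g where "g x = f x / z" for x
    have g [measurable]: "g \<in> borel_measurable m" unfolding g_def by measurable
    have lim_g: "(INF k. avg k (\<lambda>y. ennreal \<bar>g x - g y\<bar>) x) = 0"
      if "(INF k. avg k (\<lambda>y. ennreal \<bar>f x - f y\<bar>) x) = 0" for x
    proof -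
      have scale: "avg k (\<lambda>y. ennreal \<bar>g x - g y\<bar>) x = ennreal (1 / z) * avg k (\<lambda>y. ennreal \<bar>f x - f y\<bar>) x" for k
      proof -
        have "ennreal \<bar>g x - g y\<bar> = ennreal (1 / z) * ennreal \<bar>f x - f y\<bar>" for y
          using z by (simp add: g_def ennreal_mult[symmetric] flip: diff_divide_distrib)
        then show ?thesis by (simp add: avg_cmult)
      qed
      have "(INF k. avg k (\<lambda>y. ennreal \<bar>g x - g y\<bar>) x) \<le> 0"
      proof (rule ennreal_le_epsilon)
        fix e :: real assume "0 < e"
        then have "(INF k. avg k (\<lambda>y. ennreal \<bar>f x - f y\<bar>) x) < ennreal (z * e)"
          using z by (simp add: that)
        then obtain k where "avg k (\<lambda>y. ennreal \<bar>f x - f y\<bar>) x < ennreal (z * e)"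
          unfolding INF_less_iff by auto
        then have "avg k (\<lambda>y. ennreal \<bar>g x - g y\<bar>) x \<le> ennreal (1 / z) * ennreal (z * e)"
          unfolding scale by (intro mult_left_mono) auto
        also have "\<dots> = ennreal e" using z \<open>0 < e\<close> by (simp add: ennreal_mult[symmetric])
        finally show "(INF k. avg k (\<lambda>y. ennreal \<bar>g x - g y\<bar>) x) \<le> 0 + ennreal e"
          by (intro INF_lower2[of k]) auto
      qed
      then show ?thesis by simp
    qed
    have osc: "osc g x \<le> ennreal (a * (A' * S)) + ennreal b * ?J g"
      if "(INF k. avg k (\<lambda>y. ennreal \<bar>f x - f y\<bar>) x) = 0" for x
      unfolding A'_def using osc_le[OF g R lim_g[OF that]] .
    have J_ge: "ennreal (B' * S) \<le> ?J g"
    proof (rule ccontr)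
      assume "\<not> ennreal (B' * S) \<le> ?J g"
      then have lt: "?J g < ennreal (B' * S)" by simp
      then obtain j where j: "?J g = ennreal j" "0 \<le> j"
        by (cases "?J g") auto
      have nn: "0 \<le> a * (A' * S) + b * j"
        using A' S b j by (auto simp flip: mult.assoc)
      have jlt: "j < B' * S" using lt j by (simp add: ennreal_less_iff)
      have "osc g x \<le> ennreal (a * (A' * S) + b * j)"
        if "(INF k. avg k (\<lambda>y. ennreal \<bar>f x - f y\<bar>) x) = 0" for x
        using osc[OF that] A' S b j by (simp add: ennreal_mult flip: mult.assoc)
      then have "ennreal \<bar>g s - g t\<bar> \<le>
          ennreal (a * (A' * S) + b * j) + ennreal (a * (A' * S) + b * j)"
        using lim by (intro order_trans[OF osc_sum[OF g]] add_mono)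
      also have "\<dots> = ennreal (2 * (a * (A' * S) + b * j))"
        using nn unfolding mult_2 by (intro ennreal_plus[symmetric])
      finally have "\<bar>g s - g t\<bar> \<le> 2 * (a * (A' * S) + b * j)"
        using nn by (subst (asm) ennreal_le_iff) simp_all
      moreover have "\<bar>g s - g t\<bar> = 2 * K"
      proof -
        have "\<bar>g s - g t\<bar> = \<bar>f s - f t\<bar> / z"
          using z by (simp add: g_def flip: diff_divide_distrib)
        also have "\<bar>f s - f t\<bar> = z * (2 * K)" using K_pos by (simp add: z_def)
        finally show ?thesis using z by simp
      qed
      moreover have "b * j < b * (B' * S)" using b jlt by simp
      ultimately show False by (simp add: K')
    qed
    have \<phi>0: "\<phi> 0 = 0" using \<phi> unfolding class_G_def by simp
    have pt: "ennreal (\<psi> z - \<alpha>) * slope g u v \<le> ennreal \<beta> * slope f u v" for u v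
    proof -
      define x where "x = \<bar>f u - f v\<bar> / dist u v"
      have x: "0 \<le> x" by (simp add: x_def)
      have gx: "\<bar>g u - g v\<bar> / dist u v = x / z"
        using z by (simp add: g_def x_def flip: diff_divide_distrib)
      have "(\<psi> z - \<alpha>) * \<phi> (x / z) \<le> \<beta> * \<phi> x"
      proof (cases "x = 0")
        case False
        then have "0 < x / z" using x z by simp
        then have "\<psi> z \<le> \<alpha> + \<beta> * (\<phi> (z * (x / z)) / \<phi> (x / z))" "0 < \<phi> (x / z)"
          using \<psi>(2)[of z "x / z"] class_G_less[OF \<phi>, of 0 "x / z"] z \<phi>0 by auto
        then show ?thesis using z by (simp add: field_simps)
      qed (simp add: \<phi>0)
      then show ?thesis
        using False \<open>0 \<le> \<beta>\<close> x z unfolding slope_def gx x_def[symmetric]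
        by (subst (1 2) ennreal_mult[symmetric]) (auto intro!: ennreal_leI class_G_nonneg[OF \<phi>])
    qed
    have [measurable]: "(\<lambda>u. \<integral>\<^sup>+v. weight u v * slope h u v \<partial>m) \<in> borel_measurable m"
      if [measurable]: "h \<in> borel_measurable m" for h
    proof -
      have "(\<lambda>z. weight (fst z) (snd z) * slope h (fst z) (snd z)) \<in> borel_measurable (m \<Otimes>\<^sub>M m)"
        by measurable
      then show ?thesis using borel_measurable_nn_integral_fst by fastforce
    qed
    have scale: "C * ?J h = (\<integral>\<^sup>+u. \<integral>\<^sup>+v. weight u v * (C * slope h u v) \<partial>m \<partial>m)"
      if [measurable]: "h \<in> borel_measurable m" for C h
      by (simp add: nn_integral_cmult[symmetric] mult.left_commute)
    have "ennreal (\<psi> z - \<alpha>) * ennreal (B' * S) \<le> ennreal (\<psi> z - \<alpha>) * ?J g"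
      by (intro mult_left_mono J_ge) simp
    also have "\<dots> \<le> ennreal \<beta> * ?J f"
      unfolding scale[OF f] scale[OF g] by (intro nn_integral_mono mult_left_mono pt) simp
    finally have "ennreal (\<psi> z - \<alpha>) * ennreal (B' * S) / ennreal (B' * S) \<le> ennreal \<beta> * ?J f / ennreal (B' * S)"
      by (rule divide_right_mono_ennreal)
    moreover have "ennreal (\<psi> z - \<alpha>) * ennreal (B' * S) / ennreal (B' * S) = ennreal (\<psi> z - \<alpha>)"
      using B' S by (intro ennreal_mult_divide_eq) auto
    moreover have "ennreal (\<psi> z) = ennreal \<alpha> + ennreal (\<psi> z - \<alpha>)"
      using False \<open>0 \<le> \<alpha>\<close> by (simp flip: ennreal_plus)
    ultimately show ?thesis unfolding z_def[symmetric] B'_def[symmetric]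
      by (simp add: add_left_mono)
  qed
qed

lemma L1_increment_le:
  fixes X :: "'a \<Rightarrow> 'w \<Rightarrow> real"
  assumes "prob_space M" and [measurable]: "\<And>t. X t \<in> borel_measurable M"
    and "(\<integral>\<^sup>+\<omega>. ennreal (\<phi> (\<bar>X s \<omega> - X t \<omega>\<bar> / dist s t)) \<partial>M) \<le> 1"
  shows "(\<integral>\<^sup>+\<omega>. ennreal \<bar>X s \<omega> - X t \<omega>\<bar> \<partial>M) \<le> ennreal (level 0 * (a + b) * dist s t)"
proof -
  interpret M: prob_space M by fact
  let ?g = "\<lambda>\<omega>. \<bar>(X s \<omega> - X t \<omega>) / dist s t\<bar>"
  have g: "\<bar>X s \<omega> - X t \<omega>\<bar> / dist s t = ?g \<omega>" for \<omega> by simp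
  have "(\<lambda>\<omega>. ennreal (\<phi> (?g \<omega>))) \<in> borel_measurable M" by measurable
  then have [measurable]: "(\<lambda>\<omega>. ennreal (\<phi> (\<bar>X s \<omega> - X t \<omega>\<bar> / dist s t))) \<in> borel_measurable M"
    by simp
  have l: "0 \<le> level 0 * dist s t" using level_pos[of 0] by simp
  have "ennreal \<bar>X s \<omega> - X t \<omega>\<bar> \<le>
      ennreal (level 0 * dist s t) * (ennreal a + ennreal b * ennreal (\<phi> (?g \<omega>)))" for \<omega>
  proof -
    have "0 \<le> \<phi> (?g \<omega>)" by (intro class_G_nonneg[OF \<phi>]) simp
    then have "ennreal (level 0 * dist s t) * (ennreal a + ennreal b * ennreal (\<phi> (?g \<omega>))) =
      ennreal (level 0 * dist s t * (a + b * \<phi> (?g \<omega>)))"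
      using a_nonneg b_nonneg l by (simp add: ennreal_mult)
    then show ?thesis
      using increment_bound[of "\<lambda>u. X u \<omega>" s t 0] unfolding g phi_level_0
      by (simp add: ennreal_leI mult.commute)
  qed
  then have "(\<integral>\<^sup>+\<omega>. ennreal \<bar>X s \<omega> - X t \<omega>\<bar> \<partial>M) \<le>
      (\<integral>\<^sup>+\<omega>. ennreal (level 0 * dist s t) * (ennreal a + ennreal b * ennreal (\<phi> (?g \<omega>))) \<partial>M)"
    by (rule nn_integral_mono)
  also have "\<dots> = ennreal (level 0 * dist s t) *
      (ennreal a + ennreal b * (\<integral>\<^sup>+\<omega>. ennreal (\<phi> (?g \<omega>)) \<partial>M))"
    by (simp add: nn_integral_cmult nn_integral_add M.emeasure_space_1)
  also have "\<dots> \<le> ennreal (level 0 * dist s t) * (ennreal a + ennreal b * 1)"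
    using assms(3) unfolding g by (intro mult_left_mono add_left_mono) auto
  also have "\<dots> = ennreal (level 0 * (a + b) * dist s t)"
    using a_nonneg b_nonneg l by (simp add: ennreal_mult[symmetric] flip: ennreal_plus) (simp add: ac_simps)
  finally show ?thesis .
qed

context
  fixes M :: "'w measure" and Y :: "'a \<Rightarrow> 'w \<Rightarrow> real"
  assumes M: "prob_space M"
    and Y: "(\<lambda>z. Y (fst z) (snd z)) \<in> borel_measurable (m \<Otimes>\<^sub>M M)"
    and slope_Y: "\<And>s t. (\<integral>\<^sup>+\<omega>. slope (\<lambda>u. Y u \<omega>) s t \<partial>M) \<le> 1"
begin

interpretation M: prob_space M by (rule M)
interpretation mM: pair_sigma_finite m M ..

lemma measurable_Y_comp [measurable (raw)]:
  assumes [measurable]: "g \<in> N \<rightarrow>\<^sub>M m" "h \<in> N \<rightarrow>\<^sub>M M"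
  shows "(\<lambda>x. Y (g x) (h x)) \<in> borel_measurable N"
  using measurable_compose[OF measurable_Pair[OF assms] Y] by simp

lemma measurable_Y: "Y t \<in> borel_measurable M"
  by measurable

lemma measurable_path: "\<omega> \<in> space M \<Longrightarrow> (\<lambda>t. Y t \<omega>) \<in> borel_measurable m"
  by measurable

lemma AE_avg_limit: "AE \<omega> in M. (INF k. avg k (\<lambda>y. ennreal \<bar>Y x \<omega> - Y y \<omega>\<bar>) x) = 0"
proof -
  let ?L = "level 0 * (a + b)"
  have L: "0 \<le> ?L" using level_pos[of 0] a_nonneg b_nonneg by simp
  have [measurable]: "(\<lambda>\<omega>. avg k (\<lambda>y. ennreal \<bar>Y x \<omega> - Y y \<omega>\<bar>) x) \<in> borel_measurable M" for k
    unfolding avg_def by measurable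
  have le: "(\<integral>\<^sup>+\<omega>. avg k (\<lambda>y. ennreal \<bar>Y x \<omega> - Y y \<omega>\<bar>) x \<partial>M) \<le> ennreal (?L * radius k x)" for k
  proof -
    have "(\<integral>\<^sup>+\<omega>. avg k (\<lambda>y. ennreal \<bar>Y x \<omega> - Y y \<omega>\<bar>) x \<partial>M) =
        (\<integral>\<^sup>+y. \<integral>\<^sup>+\<omega>. kernel k x y * ennreal \<bar>Y x \<omega> - Y y \<omega>\<bar> \<partial>M \<partial>m)"
      unfolding avg_def by (rule mM.Fubini') measurable
    also have "\<dots> = avg k (\<lambda>y. \<integral>\<^sup>+\<omega>. ennreal \<bar>Y x \<omega> - Y y \<omega>\<bar> \<partial>M) x"
      unfolding avg_def by (intro nn_integral_cong nn_integral_cmult) measurable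
    also have "\<dots> \<le> avg k (\<lambda>_. ennreal (?L * radius k x)) x"
    proof (rule avg_mono)
      fix y assume "dist x y \<le> radius k x"
      then have "ennreal (?L * dist x y) \<le> ennreal (?L * radius k x)"
        using L by (intro ennreal_leI mult_left_mono)
      moreover have "(\<integral>\<^sup>+\<omega>. ennreal \<bar>Y x \<omega> - Y y \<omega>\<bar> \<partial>M) \<le> ennreal (?L * dist x y)"
        using slope_Y[of x y] unfolding slope_def by (intro L1_increment_le M measurable_Y)
      ultimately show "(\<integral>\<^sup>+\<omega>. ennreal \<bar>Y x \<omega> - Y y \<omega>\<bar> \<partial>M) \<le> ennreal (?L * radius k x)"
        by (rule order_trans[rotated])
    qed
    finally show ?thesis by (simp add: avg_const)
  qed
  have "(\<integral>\<^sup>+\<omega>. (INF k. avg k (\<lambda>y. ennreal \<bar>Y x \<omega> - Y y \<omega>\<bar>) x) \<partial>M) \<le> ennreal (?L * radius k x)" for k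
    by (rule order_trans[OF nn_integral_mono le[of k]]) (rule INF_lower, simp)
  moreover have "(\<lambda>k. ennreal (?L * radius k x)) \<longlonglongrightarrow> ennreal (?L * 0)"
    by (intro tendsto_intros tendsto_ennrealI radius_tendsto_0)
  ultimately have "(\<integral>\<^sup>+\<omega>. (INF k. avg k (\<lambda>y. ennreal \<bar>Y x \<omega> - Y y \<omega>\<bar>) x) \<partial>M) \<le> ennreal (?L * 0)"
    by (intro LIMSEQ_le_const) auto
  then have "(\<integral>\<^sup>+\<omega>. (INF k. avg k (\<lambda>y. ennreal \<bar>Y x \<omega> - Y y \<omega>\<bar>) x) \<partial>M) = 0" by simp
  then show ?thesis by (subst (asm) nn_integral_0_iff_AE) auto
qed

lemma measurable_slope_Y [measurable (raw)]:
  assumes [measurable]: "g \<in> N \<rightarrow>\<^sub>M m" "g' \<in> N \<rightarrow>\<^sub>M m" "h \<in> N \<rightarrow>\<^sub>M M"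
  shows "(\<lambda>x. slope (\<lambda>u. Y u (h x)) (g x) (g' x)) \<in> borel_measurable N"
proof -
  have [measurable]: "(\<lambda>x. dist (g x) (g' x)) \<in> borel_measurable N"
    using measurable_compose[OF measurable_Pair[OF assms(1,2)] measurable_dist] by simp
  show ?thesis unfolding slope_eq by measurable
qed

lemma measurable_weight_comp [measurable (raw)]:
  assumes "g \<in> N \<rightarrow>\<^sub>M m" "h \<in> N \<rightarrow>\<^sub>M m"
  shows "(\<lambda>x. weight (g x) (h x)) \<in> borel_measurable N"
  using measurable_compose[OF measurable_Pair[OF assms] measurable_weight] by simp

lemma measurable_total_energy:
  "(\<lambda>\<omega>. \<integral>\<^sup>+u. \<integral>\<^sup>+v. weight u v * slope (\<lambda>t. Y t \<omega>) u v \<partial>m \<partial>m) \<in> borel_measurable M"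
  by measurable

lemma expected_energy_le:
  "(\<integral>\<^sup>+\<omega>. \<integral>\<^sup>+u. \<integral>\<^sup>+v. weight u v * slope (\<lambda>t. Y t \<omega>) u v \<partial>m \<partial>m \<partial>M) \<le> ennreal (R ^ 2 / (R - 1) * S)"
proof -
  have "(\<integral>\<^sup>+\<omega>. \<integral>\<^sup>+u. \<integral>\<^sup>+v. weight u v * slope (\<lambda>t. Y t \<omega>) u v \<partial>m \<partial>m \<partial>M) =
      (\<integral>\<^sup>+u. \<integral>\<^sup>+\<omega>. \<integral>\<^sup>+v. weight u v * slope (\<lambda>t. Y t \<omega>) u v \<partial>m \<partial>M \<partial>m)"
    by (rule mM.Fubini') measurable
  also have "\<dots> = (\<integral>\<^sup>+u. \<integral>\<^sup>+v. \<integral>\<^sup>+\<omega>. weight u v * slope (\<lambda>t. Y t \<omega>) u v \<partial>M \<partial>m \<partial>m)"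
    by (intro nn_integral_cong mM.Fubini') measurable
  also have "\<dots> = (\<integral>\<^sup>+u. \<integral>\<^sup>+v. weight u v * (\<integral>\<^sup>+\<omega>. slope (\<lambda>t. Y t \<omega>) u v \<partial>M) \<partial>m \<partial>m)"
    by (intro nn_integral_cong nn_integral_cmult) measurable
  also have "\<dots> \<le> (\<integral>\<^sup>+u. \<integral>\<^sup>+v. weight u v * 1 \<partial>m \<partial>m)"
    by (intro nn_integral_mono mult_left_mono slope_Y) simp
  also have "\<dots> \<le> ennreal (R ^ 2 / (R - 1) * S)" using weight_mass by simp
  finally show ?thesis .
qed

end

lemma expectation_sup_le:
  fixes X :: "'a \<Rightarrow> 'w \<Rightarrow> real"
  assumes M: "prob_space M" and X: "\<And>t. X t \<in> borel_measurable M"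
    and incr: "\<And>s t. (\<integral>\<^sup>+\<omega>. ennreal (\<phi> (\<bar>X s \<omega> - X t \<omega>\<bar> / dist s t)) \<partial>M) \<le> 1"
    and R: "a = 0 \<or> 2 < R"
    and K: "K = (a * (R ^ 3 / ((R - 1) * (R - 2))) + b * (R ^ 2 / (R - 1))) * S"
    and S: "0 < S"
    and \<psi>: "\<psi> 0 = 0" "\<And>x y. x \<ge> 0 \<Longrightarrow> y > 0 \<Longrightarrow> \<psi> x \<le> \<alpha> + \<beta> * (\<phi> (x * y) / \<phi> y)"
    and \<alpha>\<beta>: "0 \<le> \<alpha>" "0 \<le> \<beta>"
  shows "expectation_sup M (\<lambda>s t \<omega>. \<psi> (\<bar>X s \<omega> - X t \<omega>\<bar> / (2 * K))) \<le> ennreal (\<alpha> + \<beta>)"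
proof -
  interpret M: prob_space M by (rule M)
  have L: "0 \<le> level 0 * (a + b)" using level_pos[of 0] a_nonneg b_nonneg by simp
  obtain Y where Y: "(\<lambda>z. Y (fst z) (snd z)) \<in> borel_measurable (borel \<Otimes>\<^sub>M M)"
    and YX: "\<And>t. AE \<omega> in M. Y t \<omega> = X t \<omega>"
    using measurable_modification[OF X L1_increment_le[OF M X incr] L] by blast
  have Ym: "(\<lambda>z. Y (fst z) (snd z)) \<in> borel_measurable (m \<Otimes>\<^sub>M M)"
    using Y unfolding measurable_cong_sets[OF sets_pair_measure_cong[OF sets_m refl] refl] .
  have slope_Y: "(\<integral>\<^sup>+\<omega>. slope (\<lambda>u. Y u \<omega>) s t \<partial>M) \<le> 1" for s t
  proof -
    have "(\<integral>\<^sup>+\<omega>. slope (\<lambda>u. Y u \<omega>) s t \<partial>M) =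
        (\<integral>\<^sup>+\<omega>. ennreal (\<phi> (\<bar>X s \<omega> - X t \<omega>\<bar> / dist s t)) \<partial>M)"
      unfolding slope_def using YX[of s] YX[of t] by (intro nn_integral_cong_AE) auto
    then show ?thesis using incr[of s t] by simp
  qed
  let ?J = "\<lambda>\<omega>. \<integral>\<^sup>+u. \<integral>\<^sup>+v. weight u v * slope (\<lambda>t. Y t \<omega>) u v \<partial>m \<partial>m"
  let ?C = "ennreal (R ^ 2 / (R - 1) * S)"
  have J [measurable]: "?J \<in> borel_measurable M" by (rule measurable_total_energy[OF M Ym slope_Y])
  have C: "?C \<noteq> 0" "?C \<noteq> \<infinity>" using R_ge_2 S by auto
  have "(\<integral>\<^sup>+\<omega>. (SUP s\<in>F. SUP t\<in>F. ennreal (\<psi> (\<bar>X s \<omega> - X t \<omega>\<bar> / (2 * K)))) \<partial>M) \<le> ennreal (\<alpha> + \<beta>)"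
    if "finite F" for F
  proof -
    have "AE \<omega> in M. \<forall>t\<in>F. Y t \<omega> = X t \<omega> \<and> (INF k. avg k (\<lambda>y. ennreal \<bar>Y t \<omega> - Y y \<omega>\<bar>) t) = 0"
      using YX AE_avg_limit[OF M Ym slope_Y] that by (intro AE_finite_allI) auto
    then have "AE \<omega> in M. (SUP s\<in>F. SUP t\<in>F. ennreal (\<psi> (\<bar>X s \<omega> - X t \<omega>\<bar> / (2 * K)))) \<le>
        ennreal \<alpha> + ennreal \<beta> * ?J \<omega> / ?C"
    proof (rule AE_mp[OF _ AE_I2], intro impI SUP_least)
      fix \<omega> s t
      assume \<omega>: "\<omega> \<in> space M" "s \<in> F" "t \<in> F"
        "\<forall>t\<in>F. Y t \<omega> = X t \<omega> \<and> (INF k. avg k (\<lambda>y. ennreal \<bar>Y t \<omega> - Y y \<omega>\<bar>) t) = 0"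
      have "ennreal (\<psi> (\<bar>Y s \<omega> - Y t \<omega>\<bar> / (2 * K))) \<le> ennreal \<alpha> + ennreal \<beta> * ?J \<omega> / ?C"
        using \<omega> by (intro psi_le_energy[OF measurable_path[OF M Ym slope_Y] R _ _ K S \<psi> \<alpha>\<beta>]) auto
      then show "ennreal (\<psi> (\<bar>X s \<omega> - X t \<omega>\<bar> / (2 * K))) \<le> ennreal \<alpha> + ennreal \<beta> * ?J \<omega> / ?C"
        using \<omega> by simp
    qed
    then have "(\<integral>\<^sup>+\<omega>. (SUP s\<in>F. SUP t\<in>F. ennreal (\<psi> (\<bar>X s \<omega> - X t \<omega>\<bar> / (2 * K)))) \<partial>M) \<le>
        (\<integral>\<^sup>+\<omega>. ennreal \<alpha> + ennreal \<beta> * ?J \<omega> / ?C \<partial>M)"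
      by (rule nn_integral_mono_AE)
    also have "\<dots> = ennreal \<alpha> + ennreal \<beta> * (\<integral>\<^sup>+\<omega>. ?J \<omega> \<partial>M) / ?C"
      by (simp add: nn_integral_add nn_integral_cmult nn_integral_divide M.emeasure_space_1)
    also have "\<dots> \<le> ennreal \<alpha> + ennreal \<beta> * ?C / ?C"
      by (intro add_left_mono divide_right_mono_ennreal mult_left_mono
          expected_energy_le[OF M Ym slope_Y]) simp
    also have "ennreal \<beta> * ?C / ?C = ennreal \<beta>" using C by (intro ennreal_mult_divide_eq) auto
    also have "ennreal \<alpha> + ennreal \<beta> = ennreal (\<alpha> + \<beta>)" using \<alpha>\<beta> by simp
    finally show ?thesis .
  qed
  then show ?thesis unfolding expectation_sup_def by (intro SUP_least) simp
qed

end

theorem theorem3p2: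
  fixes m :: "'a::metric_space measure"
    and M :: "'w measure"
    and X :: "'a \<Rightarrow> 'w \<Rightarrow> real"
    and \<phi> \<psi> :: "real \<Rightarrow> real"
    and a b R B \<alpha> \<beta> :: real
    and A K :: ennreal
  assumes "prob_space m" and "sets m = sets borel" and "msupport m = UNIV"
    and "a \<ge> 0" and "b \<ge> 0" and "\<phi> \<in> class_G a b" and "R \<ge> 2"
    and "A = (if R = 2 then \<infinity> else ennreal (R ^ 3 / ((R - 1) * (R - 2))))"
    and "B = R ^ 2 / (R - 1)"
    and "K = (ennreal a * A + ennreal (b * B)) * majorizing_S m \<phi>"
    and "mono_on {0..} \<psi>" and "continuous_on {0..} \<psi>" and "\<psi> 0 = 0"
    and "\<alpha> \<ge> 0" and "\<beta> \<ge> 0"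
    and "\<And>x y. x \<ge> 0 \<Longrightarrow> y > 0 \<Longrightarrow> \<psi> x \<le> \<alpha> + \<beta> * (\<phi> (x * y) / \<phi> y)"
    and "prob_space M" and "\<And>t. X t \<in> borel_measurable M" and "separable_process M X"
    and "(SUP s. SUP t. \<integral>\<^sup>+\<omega>. ennreal (\<phi> (\<bar>X s \<omega> - X t \<omega>\<bar> / dist s t)) \<partial>M) \<le> 1"
  shows "expectation_sup M (\<lambda>s t \<omega>. \<psi> (ext_div \<bar>X s \<omega> - X t \<omega>\<bar> (2 * K))) \<le> ennreal (\<alpha> + \<beta>)"
proof (cases "K = 0 \<or> K = \<infinity>")
  case True
  then have "ext_div u (2 * K) = 0" for u
    by (auto simp: ext_div_def ennreal_mult_top)
  moreover have "(SUP s\<in>F. SUP t\<in>F. 0 :: ennreal) = 0" for F :: "'a set"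
    by (cases "F = {}") (auto simp: bot_ennreal)
  ultimately show ?thesis
    unfolding expectation_sup_def by (intro SUP_least) (simp add: assms(13))
next
  case False
  interpret M: prob_space M by fact
  have b: "0 < b" by (rule class_G_b_pos) fact+
  have B: "0 < B" using assms(7,9) by simp
  have S: "majorizing_S m \<phi> \<noteq> 0" "majorizing_S m \<phi> < \<infinity>"
    using False b B assms(10) by (auto simp: ennreal_mult_eq_top_iff less_top)
  have aA: "ennreal a * A \<noteq> \<infinity>"
    using False S unfolding assms(10) by (auto simp: ennreal_mult_eq_top_iff)
  have R: "a = 0 \<or> 2 < R"
    using aA assms(4,7,8) by (auto simp: ennreal_mult_top split: if_splits)
  obtain C where "countable C" and sep: "AE \<omega> in M. \<forall>t. \<exists>s :: nat \<Rightarrow> 'a. (\<forall>n. s n \<in> C) \<and> s \<longlonglongrightarrow> t \<and>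
        (\<lambda>n. X (s n) \<omega>) \<longlonglongrightarrow> X t \<omega>"
    using assms(19) unfolding separable_process_def by blast
  have "closure C = UNIV"
  proof -
    have "\<exists>\<omega>. \<forall>t. \<exists>s :: nat \<Rightarrow> 'a. (\<forall>n. s n \<in> C) \<and> s \<longlonglongrightarrow> t \<and> (\<lambda>n. X (s n) \<omega>) \<longlonglongrightarrow> X t \<omega>"
      using eventually_happens'[OF M.ae_filter_bot sep] .
    then show ?thesis unfolding closure_sequential set_eq_iff by blast
  qed
  then obtain c :: "nat \<Rightarrow> 'a" and q :: "nat \<Rightarrow> 'a \<Rightarrow> nat"
    where q: "\<And>n. q n \<in> borel \<rightarrow>\<^sub>M count_space UNIV"
      and dist_q: "\<And>n x. dist x (c (q n x)) < (1 / 2) ^ n"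
    using countable_dense_approximation[OF \<open>countable C\<close>, of thesis] by iprover
  have "majorizing_chain m c q \<phi> a b R"
    by (intro majorizing_chain.intro dense_metric.intro majorizing_chain_axioms.intro q dist_q S(2)) fact+
  then interpret majorizing_chain m c q \<phi> a b R .
  define k where "k = (a * (R ^ 3 / ((R - 1) * (R - 2))) + b * (R ^ 2 / (R - 1))) * S"
  have mS: "majorizing_S m \<phi> = ennreal S" using S by (simp add: S_def less_top)
  have S_pos: "0 < S" using S(1) S_nonneg by (auto simp: mS less_le)
  have "ennreal a * A = ennreal (a * (R ^ 3 / ((R - 1) * (R - 2))))"
    using R assms(4) by (auto simp: assms(8) ennreal_mult[symmetric])
  then have K: "K = ennreal k"
    using R assms(4) b B S_nonneg
    unfolding assms(10) mS k_def assms(9)[symmetric]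
    by (subst ennreal_mult) (auto intro!: ennreal_plus[symmetric])
  have "0 < k" using False K by (auto simp: ennreal_eq_0_iff not_le)
  then have "ext_div u (2 * K) = u / (2 * k)" for u
    by (simp add: ext_div_def K ennreal_mult_eq_top_iff enn2real_mult)
  moreover have "(\<integral>\<^sup>+\<omega>. ennreal (\<phi> (\<bar>X s \<omega> - X t \<omega>\<bar> / dist s t)) \<partial>M) \<le> 1" for s t
    using assms(20) by (simp add: SUP_le_iff)
  ultimately show ?thesis
    using expectation_sup_le[OF assms(17,18) _ R k_def S_pos assms(13,16,14,15)] by simp
qed

end
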